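(* For every positive integer $n$, there is a prime $p$ with $3n \le p \le 4n$. Moreover, for every integer $n \ge 2$, there is a prime $p$ with $3n < p < 4n$. *)

theory Defs
  imports Complex_Main "HOL-Computational_Algebra.Primes"
begin

end

theory Submission
  imports Defs "HOL-Number_Theory.Prime_Powers"
begin

text \<open>
  Write \<open>\<psi>(x)\<close> for the sum of the von Mangoldt function \<open>\<Lambda>\<close> over the integers up to \<open>x\<close>. Chebyshev's
  elementary method encloses \<open>\<psi>(x)\<close> between \<open>A x\<close> and \<open>(6/5) A x\<close>, up to errors of order
  \<open>sqrt x\<close>, where \<open>A = ln 2 / 2 + ln 3 / 3 + ln 5 / 5 - ln 30 / 30\<close>. Since \<open>6/5 < 4/3\<close>, the
  difference \<open>\<psi>(4n) - \<psi>(3n)\<close> is at least \<open>(4 - 18/5) A n\<close> minus such an error, so it grows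
  linearly in \<open>n\<close>.

  Chebyshev's bounds come from the alternating combination
  \<open>U(n) = T(n) - T(n/2) - T(n/3) - T(n/5) + T(n/30)\<close>, with \<open>T(x)\<close> the logarithm of the factorial
  of the integer part of \<open>x\<close>. On the one hand, \<open>T(x)\<close> is the sum of \<open>\<Lambda>(d)\<close> times the integer part
  of \<open>x/d\<close>. So \<open>U(n)\<close> is a sum of values \<open>\<Lambda>(d)\<close> with coefficients that turn out to be 0 or 1, and
  to be 1 for \<open>d > n/6\<close>; this gives \<open>\<psi>(n) - \<psi>(n/6) \<le> U(n) \<le> \<psi>(n)\<close>
  (\<open>psi_diff_le_factorial_ratio\<close>, \<open>factorial_ratio_le_psi\<close>). On the other hand,
  \<open>1 - 1/2 - 1/3 - 1/5 + 1/30 = 0\<close>, so in Stirling's approximation the terms of order \<open>n ln n\<close>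
  and the terms \<open>-x\<close> cancel and \<open>U(n) = A n + O(sqrt n)\<close> (\<open>factorial_ratio_approx\<close>). Iterating
  the upper bound along \<open>n, n/6, n/36, ...\<close> yields the factor \<open>6/5 = 1/(1 - 1/6)\<close> (\<open>psi_le\<close>).

  The difference \<open>\<psi>(4n) - \<psi>(3n)\<close> also counts proper powers of primes, but these contribute
  little: every prime has at most one power in \<open>(3n, 4n]\<close>, and a prime with a proper power there
  is at most \<open>sqrt (4n)\<close>, so together they contribute at most \<open>\<psi>(sqrt (4n))\<close>
  (\<open>sum_mangoldt_composite_le\<close>). The constants are good enough for all \<open>n \<ge> 10000\<close>; smaller \<open>n\<close> are
  covered by thirty primes, each less than 4/3 times its predecessor up to rounding
  (\<open>prime_chain_covers\<close>).
\<close>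

section \<open>Factorials along the reals\<close>

definition stirling_main :: "real \<Rightarrow> real" where
  "stirling_main x = x * ln x - x"

text \<open>
  The function is convex with derivative \<open>ln\<close>, so its graph lies above its tangents. This
  inequality serves as a substitute for all comparisons of \<open>ln\<close> with an integral.
\<close>
lemma stirling_main_tangent:
  assumes "x > 0" "y \<ge> 0"
  shows "stirling_main y \<ge> stirling_main x + (y - x) * ln x"
proof (cases "y = 0")
  case True
  then show ?thesis using assms by (simp add: stirling_main_def)
next
  case False
  with assms have y: "y > 0" by simp
  have "ln (x / y) \<le> x / y - 1"
    using assms y by (intro ln_le_minus_one) simp
  hence "y * (ln x - ln y) \<le> y * (x / y - 1)"
    using assms y by (intro mult_left_mono) (simp_all add: ln_div)
  thus ?thesis using y by (simp add: stirling_main_def algebra_simps)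
qed

lemma ln_fact_bounds:
  assumes "n \<ge> 1"
  shows "stirling_main (real n) + 1 \<le> ln (fact n)"
    and "ln (fact n) \<le> stirling_main (real n) + 1 + ln (real n)"
proof -
  have "stirling_main (real n) + 1 \<le> ln (fact n) \<and>
        ln (fact n) \<le> stirling_main (real n) + 1 + ln (real n)"
    using assms
  proof (induction n rule: dec_induct)
    case base
    show ?case by (simp add: stirling_main_def)
  next
    case (step n)
    have "ln (fact (Suc n) :: real) = ln (real (Suc n)) + ln (fact n)"
      using step.hyps by (simp add: ln_mult del: of_nat_Suc)
    moreover have "stirling_main (real (Suc n)) \<ge> stirling_main (real n) + ln (real n)"
      using stirling_main_tangent[of "real n" "real (Suc n)"] step.hyps by simp
    moreover have "stirling_main (real n) \<ge> stirling_main (real (Suc n)) - ln (real (Suc n))"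
      using stirling_main_tangent[of "real (Suc n)" "real n"] by simp
    ultimately show ?case using step.IH by linarith
  qed
  thus "stirling_main (real n) + 1 \<le> ln (fact n)"
    and "ln (fact n) \<le> stirling_main (real n) + 1 + ln (real n)" by auto
qed

text \<open>
  The bounds carry over from \<open>m\<close> to real \<open>x\<close> with integer part \<open>m\<close>: the main term is increasing
  on \<open>[1, \<infinity>)\<close>, so it can be compared at \<open>m \<le> x\<close> for the upper bound and at \<open>x \<le> m + 1\<close> for the
  lower one. The error is \<open>ln (1 + x)\<close> rather than \<open>ln x\<close> so that the bounds hold for \<open>0 \<le> x < 1\<close>
  as well, where the main term lies between \<open>-1\<close> and 0; no lower limit on \<open>n\<close> is then needed
  when \<open>x = n / 30\<close>.
\<close>
lemma ln_fact_floor_bounds: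
  assumes "real m \<le> x" "x < real m + 1"
  shows "stirling_main x - ln (1 + x) \<le> ln (fact m)"
    and "ln (fact m) \<le> stirling_main x + 1 + ln (1 + x)"
proof -
  have x0: "x \<ge> 0" using assms by linarith
  have "stirling_main x - ln (1 + x) \<le> ln (fact m) \<and>
        ln (fact m) \<le> stirling_main x + 1 + ln (1 + x)"
  proof (cases "m = 0")
    case True
    have "x * ln x \<le> 0" using x0 assms True
      by (cases "x = 0") (auto intro: mult_nonneg_nonpos)
    hence "stirling_main x \<le> 0" using x0 by (simp add: stirling_main_def)
    moreover have "stirling_main x \<ge> -1"
      using stirling_main_tangent[of 1 x] x0 by (simp add: stirling_main_def)
    moreover have "ln (1 + x) \<ge> 0" using x0 by simp
    ultimately show ?thesis using True by simp
  next
    case False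
    hence m: "m \<ge> 1" by simp
    have x1: "x \<ge> 1" using m assms by linarith
    have "stirling_main x \<ge> stirling_main (real m) + (x - real m) * ln (real m)"
      by (rule stirling_main_tangent) (use m x0 in auto)
    moreover have "(x - real m) * ln (real m) \<ge> 0" using m assms by simp
    moreover have "ln (real m) \<le> ln (1 + x)" using m assms by simp
    moreover have "stirling_main (real (Suc m)) \<ge>
        stirling_main x + (real (Suc m) - x) * ln x"
      by (rule stirling_main_tangent) (use x1 in auto)
    moreover have "(real (Suc m) - x) * ln x \<ge> 0" using x1 assms by simp
    moreover have "ln (fact (Suc m) :: real) = ln (real (Suc m)) + ln (fact m)"
      by (simp add: ln_mult del: of_nat_Suc)
    moreover have "ln (real (Suc m)) \<le> ln (1 + x)" using x0 assms by simp
    ultimately show ?thesis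
      using ln_fact_bounds[of m] ln_fact_bounds(1)[of "Suc m"] m by linarith
  qed
  thus "stirling_main x - ln (1 + x) \<le> ln (fact m)"
    and "ln (fact m) \<le> stirling_main x + 1 + ln (1 + x)" by auto
qed

text \<open>
  Replacing logarithmic errors by multiples of \<open>sqrt n\<close> makes the errors at \<open>n, n/6, n/36, ...\<close>
  a geometric series, and makes the final comparison a quadratic inequality in \<open>sqrt n\<close>.
\<close>
lemma ln_one_plus_le_sqrt:
  assumes "y \<ge> (0::real)"
  shows "ln (1 + y) \<le> sqrt y"
proof -
  define s where "s = sqrt y"
  have s: "s \<ge> 0" "y = s^2" using assms by (auto simp: s_def)
  \<comment> \<open>The quadratic Taylor bound at \<open>s\<close> itself is at least \<open>1 + s^2\<close> only for \<open>s \<le> 2\<close>; squaring the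
      bound at \<open>s/2\<close> works for all \<open>s\<close>.\<close>
  have "1 + s^2 \<le> (1 + s/2 + (s/2)^2/2)^2"
  proof -
    have "(1 + s/2 + (s/2)^2/2)^2 - (1 + s^2) = s * ((1 - s/4)^2 + s^2/16) + s^4/64"
      by (simp add: power2_eq_square power4_eq_xxxx field_simps)
    moreover have "s * ((1 - s/4)^2 + s^2/16) + s^4/64 \<ge> 0" using s by simp
    ultimately show ?thesis by linarith
  qed
  also have "\<dots> \<le> exp (s/2) ^ 2"
    using s by (intro power_mono exp_lower_Taylor_quadratic add_nonneg_nonneg) auto
  also have "\<dots> = exp s" by (simp flip: exp_double)
  finally have "1 + y \<le> exp s" using s by simp
  hence "ln (1 + y) \<le> ln (exp s)" using assms by (subst ln_le_cancel_iff) auto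
  thus ?thesis by (simp add: s_def)
qed

section \<open>Chebyshev's factorial ratio\<close>

definition chebyshev_psi :: "nat \<Rightarrow> real" where
  "chebyshev_psi n = (\<Sum>d\<in>{1..n}. mangoldt d)"

lemma chebyshev_psi_split:
  assumes "m \<le> n"
  shows "chebyshev_psi n = chebyshev_psi m + (\<Sum>d\<in>{m<..n}. mangoldt d)"
proof -
  have "{1..n} = {1..m} \<union> {m<..n}" using assms by auto
  thus ?thesis unfolding chebyshev_psi_def by (simp add: sum.union_disjoint ivl_disj_int)
qed

text \<open>
  The logarithm of \<open>n! (n/30)! / ((n/2)! (n/3)! (n/5)!)\<close> with all quotients rounded down, the
  quotient of factorials that Chebyshev used.
\<close>
definition factorial_ratio :: "nat \<Rightarrow> real" where
  "factorial_ratio n = ln (fact n) - ln (fact (n div 2)) - ln (fact (n div 3))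
     - ln (fact (n div 5)) + ln (fact (n div 30))"

text \<open>
  The coefficient of \<open>\<Lambda>(d)\<close> in \<open>factorial_ratio n\<close>, as a function of \<open>m = n div d\<close>.
\<close>
definition ratio_coeff :: "nat \<Rightarrow> int" where
  "ratio_coeff m = int m - int (m div 2) - int (m div 3) - int (m div 5) + int (m div 30)"

text \<open>
  Passing from \<open>m\<close> to \<open>m + 1\<close> raises \<open>m div d\<close> by 1 exactly for the divisors \<open>d\<close> of \<open>m + 1\<close>, and
  \<open>\<Lambda>\<close> sums to \<open>ln (m + 1)\<close> over these. The sum extends to an arbitrary \<open>n \<ge> m\<close>, where the
  additional terms vanish, so that the sums for several factorials can be combined termwise.
\<close>
lemma ln_fact_eq_sum_mangoldt:
  assumes "m \<le> n"
  shows "ln (fact m) = (\<Sum>d\<in>{1..n}. mangoldt d * real (m div d))"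
  using assms
proof (induction m)
  case 0
  show ?case by simp
next
  case (Suc m)
  have "(\<Sum>d\<in>{1..n}. mangoldt d * real (Suc m div d)) =
        (\<Sum>d\<in>{1..n}. mangoldt d * real (m div d) + (if d dvd Suc m then mangoldt d else 0))"
    by (intro sum.cong refl) (simp add: div_Suc dvd_eq_mod_eq_0 algebra_simps)
  also have "\<dots> = ln (fact m) + (\<Sum>d\<in>{d\<in>{1..n}. d dvd Suc m}. mangoldt d)"
    using Suc by (simp add: sum.distrib flip: sum.inter_filter)
  also have "{d\<in>{1..n}. d dvd Suc m} = {d. d dvd Suc m}"
    using Suc.prems by (auto dest: dvd_imp_le intro: Nat.gr0I simp: Suc_le_eq)
  also have "(\<Sum>d | d dvd Suc m. mangoldt d) = ln (real (Suc m))"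
    using mangoldt_sum[of "Suc m", where ?'a = real] by simp
  also have "ln (fact m) + ln (real (Suc m)) = ln (fact (Suc m))"
    by (simp add: ln_mult del: of_nat_Suc)
  finally show ?case by simp
qed

lemma factorial_ratio_eq_sum:
  "factorial_ratio n = (\<Sum>d\<in>{1..n}. mangoldt d * real_of_int (ratio_coeff (n div d)))"
proof -
  have T: "ln (fact (n div k)) = (\<Sum>d\<in>{1..n}. mangoldt d * real (n div d div k))" for k
    by (subst ln_fact_eq_sum_mangoldt[of _ n])
       (simp_all add: div_mult2_eq[symmetric] mult.commute)
  have T1: "ln (fact n) = (\<Sum>d\<in>{1..n}. mangoldt d * real (n div d))"
    by (rule ln_fact_eq_sum_mangoldt) simp
  show ?thesis unfolding factorial_ratio_def T T1 ratio_coeff_def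
    by (simp add: sum.distrib sum_subtractf algebra_simps)
qed

text \<open>
  Because \<open>1 - 1/2 - 1/3 - 1/5 + 1/30 = 0\<close>, the coefficient has period 30, so thirty values
  decide.
\<close>
lemma ratio_coeff_bounds: "0 \<le> ratio_coeff m" "ratio_coeff m \<le> 1"
proof -
  define q r where "q = m div 30" and "r = m mod 30"
  have m: "m = r + 30 * q" and r: "r < 30" by (auto simp: q_def r_def)
  have "m div 2 = r div 2 + 15 * q" "m div 3 = r div 3 + 10 * q" "m div 5 = r div 5 + 6 * q"
    "m div 30 = q"
    using r by (simp_all add: m)
  hence c: "ratio_coeff m = int r - int (r div 2) - int (r div 3) - int (r div 5)"
    by (simp add: ratio_coeff_def m)
  have "r \<in> set [0..<30]" using r by simp
  hence "0 \<le> ratio_coeff m \<and> ratio_coeff m \<le> 1"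
    unfolding c by (auto simp: upt_rec_numeral)
  thus "0 \<le> ratio_coeff m" "ratio_coeff m \<le> 1" by auto
qed

lemma ratio_coeff_eq_1:
  assumes "1 \<le> m" "m < 6"
  shows "ratio_coeff m = 1"
proof -
  have "m \<in> {1,2,3,4,5}" using assms by auto
  thus ?thesis by (auto simp: ratio_coeff_def)
qed

lemma factorial_ratio_le_psi: "factorial_ratio n \<le> chebyshev_psi n"
  unfolding factorial_ratio_eq_sum chebyshev_psi_def
  using ratio_coeff_bounds(2)
  by (intro sum_mono mult_left_le) (auto simp: mangoldt_nonneg)

text \<open>
  For \<open>n/6 < d \<le> n\<close> the quotient \<open>n div d\<close> lies between 1 and 5, where the coefficient is 1. The
  remaining terms are nonnegative.
\<close>
lemma psi_diff_le_factorial_ratio: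
  "chebyshev_psi n \<le> chebyshev_psi (n div 6) + factorial_ratio n"
proof -
  have "(\<Sum>d\<in>{1..n}. mangoldt d * real_of_int (ratio_coeff (n div d))) \<ge>
        (\<Sum>d\<in>{n div 6<..n}. mangoldt d * real_of_int (ratio_coeff (n div d)))"
    using ratio_coeff_bounds(1)
    by (intro sum_mono2) (auto simp: mangoldt_nonneg)
  also have "(\<Sum>d\<in>{n div 6<..n}. mangoldt d * real_of_int (ratio_coeff (n div d))) =
             (\<Sum>d\<in>{n div 6<..n}. mangoldt d)"
  proof (intro sum.cong refl)
    fix d assume d: "d \<in> {n div 6<..n}"
    hence "1 \<le> n div d" by (simp add: div_greater_zero_iff Suc_le_eq)
    moreover have "n div d < 6"
      using d by (auto simp: less_mult_imp_div_less div_less_iff_less_mult mult.commute)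
    ultimately show "mangoldt d * real_of_int (ratio_coeff (n div d)) = mangoldt d"
      by (simp add: ratio_coeff_eq_1)
  qed
  finally have "factorial_ratio n \<ge> (\<Sum>d\<in>{n div 6<..n}. mangoldt d)"
    by (simp add: factorial_ratio_eq_sum)
  thus ?thesis using chebyshev_psi_split[of "n div 6" n] by simp
qed

section \<open>Chebyshev's bounds\<close>

definition chebyshev_const :: real where
  "chebyshev_const = ln 2 / 2 + ln 3 / 3 + ln 5 / 5 - ln 30 / 30"

text \<open>
  Thirty times the constant is the logarithm of \<open>2^14 * 3^9 * 5^5\<close>, which is about \<open>10^12\<close>, so
  \<open>5/2 \<le> exp 1 \<le> 3\<close> suffices for these bounds. The true value is about 0.9213.
\<close>
lemma chebyshev_const_bounds: "5/6 \<le> chebyshev_const" "chebyshev_const \<le> 11/10"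
proof -
  have "ln (30::real) = ln 2 + ln 3 + ln 5"
    using ln_mult[of 2 "15::real"] ln_mult[of 3 "5::real"] by simp
  hence "30 * chebyshev_const = 14 * ln 2 + 9 * ln 3 + 5 * ln 5"
    by (simp add: chebyshev_const_def field_simps)
  also have "\<dots> = ln (2^14 * 3^9 * 5^5)"
  proof -
    have "ln (a ^ 14 * b ^ 9 * c ^ 5) = 14 * ln a + 9 * ln b + 5 * ln c"
      if "a > 0" "b > 0" "c > 0" for a b c :: real
      using that by (simp add: ln_mult ln_realpow)
    from this[of 2 3 5] show ?thesis by simp
  qed
  finally have eq: "30 * chebyshev_const = ln (2^14 * 3^9 * 5^5)" .
  have "exp (25::real) = exp 1 ^ 25" by (simp flip: exp_of_nat_mult)
  also have "\<dots> \<le> 3 ^ 25" by (intro power_mono exp_le) simp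
  also have "\<dots> \<le> 2^14 * 3^9 * 5^5" by simp
  finally have "25 \<le> ln (2^14 * 3^9 * 5^5 :: real)" by (subst ln_ge_iff) auto
  thus "5/6 \<le> chebyshev_const" using eq by linarith
  have "2^14 * 3^9 * 5^5 \<le> (5/2::real) ^ 33" by (simp add: power_divide)
  also have "\<dots> \<le> exp 1 ^ 33"
    using exp_lower_Taylor_quadratic[of 1] by (intro power_mono) auto
  also have "\<dots> = exp 33" by (simp flip: exp_of_nat_mult)
  finally have "ln (2^14 * 3^9 * 5^5 :: real) \<le> ln (exp 33)"
    by (subst ln_le_cancel_iff) auto
  thus "chebyshev_const \<le> 11/10" using eq by simp
qed

lemma sqrt_div_le:
  assumes "n \<ge> 0" "c \<ge> 0" "1 / k \<le> c ^ 2"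
  shows "sqrt (n / k) \<le> c * sqrt n"
proof -
  have "n / k \<le> c^2 * n" using mult_left_mono[OF assms(3,1)] by (simp add: mult.commute)
  hence "sqrt (n / k) \<le> sqrt (c^2 * n)" by simp
  also have "\<dots> = c * sqrt n" using assms by (simp add: real_sqrt_mult)
  finally show ?thesis .
qed

text \<open>
  The five Stirling errors \<open>ln (1 + n/k)\<close> are at most \<open>sqrt (n/k)\<close>, and \<open>1/sqrt k\<close> summed over
  \<open>k = 1, 2, 3, 5, 30\<close> stays below 3. The constant 3 comes from the summand 1 in the three
  upper bounds for the factorials that enter with a negative sign.
\<close>
lemma factorial_ratio_approx:
  "\<bar>factorial_ratio n - chebyshev_const * real n\<bar> \<le> 3 + 3 * sqrt (real n)"
proof (cases "n = 0")
  case True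
  then show ?thesis by (simp add: factorial_ratio_def)
next
  case False
  define h where "h = (\<lambda>k. stirling_main (real n / k))"
  define e where "e = (\<lambda>k. ln (1 + real n / k))"
  have T: "h (real k) - e (real k) \<le> ln (fact (n div k))"
          "ln (fact (n div k)) \<le> h (real k) + 1 + e (real k)" if "k > 0" for k
  proof -
    have "real (n div k) \<le> real n / real k" by (rule of_nat_div_le_of_nat)
    moreover have "n < (n div k + 1) * k"
      using that by (metis Suc_eq_plus1 dividend_less_div_times mult_Suc add.commute)
    hence "real n < real ((n div k + 1) * k)" by (subst of_nat_less_iff)
    hence "real n / real k < real (n div k) + 1" using that by (simp add: field_simps)
    ultimately show "h (real k) - e (real k) \<le> ln (fact (n div k))"
          "ln (fact (n div k)) \<le> h (real k) + 1 + e (real k)"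
      unfolding h_def e_def by (rule ln_fact_floor_bounds)+
  qed
  \<comment> \<open>The coefficients of \<open>n ln n\<close> and of \<open>n\<close> cancel; what is left are the terms \<open>n ln k / k\<close>.\<close>
  have main: "h 1 - h 2 - h 3 - h 5 + h 30 = chebyshev_const * real n"
    using False by (simp add: h_def stirling_main_def chebyshev_const_def ln_div field_simps)
  have e: "e k \<le> c * sqrt (real n)" if "k > 0" "c \<ge> 0" "1 / k \<le> c^2" for k c
  proof -
    have "e k \<le> sqrt (real n / k)"
      unfolding e_def using that by (intro ln_one_plus_le_sqrt) simp
    also have "\<dots> \<le> c * sqrt (real n)" by (rule sqrt_div_le) (use that in auto)
    finally show ?thesis .
  qed
  \<comment> \<open>The factors are \<open>1 / sqrt k\<close> rounded up; their sum is 2.93.\<close>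
  have "e 1 \<le> 1 * sqrt (real n)" "e 2 \<le> (71/100) * sqrt (real n)"
       "e 3 \<le> (58/100) * sqrt (real n)" "e 5 \<le> (45/100) * sqrt (real n)"
       "e 30 \<le> (19/100) * sqrt (real n)"
    by (rule e; simp add: power2_eq_square)+
  moreover have "sqrt (real n) \<ge> 0" by simp
  ultimately have "e 1 + e 2 + e 3 + e 5 + e 30 \<le> 3 * sqrt (real n)" by argo
  thus ?thesis
    using T[of 1] T[of 2] T[of 3] T[of 5] T[of 30] main
    unfolding factorial_ratio_def abs_le_iff by simp
qed

lemma psi_ge: "chebyshev_const * real n - 3 - 3 * sqrt (real n) \<le> chebyshev_psi n"
  using factorial_ratio_approx[of n] factorial_ratio_le_psi[of n] by linarith

text \<open>
  One step costs \<open>A n + 6 sqrt n\<close> and passes to \<open>n div 6\<close>. The main terms add up to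
  \<open>A n (1 + 1/6 + 1/36 + ...) = (6/5) A n\<close>. The factor 11 of \<open>sqrt n\<close> reproduces itself because
  \<open>11/sqrt 6 + 6 < 11\<close>.
\<close>
lemma psi_le: "chebyshev_psi n \<le> 6/5 * chebyshev_const * real n + 11 * sqrt (real n)"
proof (induction n rule: less_induct)
  case (less n)
  show ?case
  proof (cases "n = 0")
    case True
    then show ?thesis by (simp add: chebyshev_psi_def)
  next
    case False
    hence s1: "sqrt (real n) \<ge> 1" by simp
    have d: "real (n div 6) \<le> real n / 6"
      using of_nat_div_le_of_nat[of n 6] by simp
    have "chebyshev_psi (n div 6) \<le>
        6/5 * chebyshev_const * real (n div 6) + 11 * sqrt (real (n div 6))"
      using False by (intro less) simp
    moreover have "chebyshev_const * real (n div 6) \<le> chebyshev_const * (real n / 6)"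
      using d chebyshev_const_bounds by (intro mult_left_mono) auto
    moreover have "sqrt (real (n div 6)) \<le> (41/100) * sqrt (real n)"
    proof -
      have "sqrt (real (n div 6)) \<le> sqrt (real n / 6)" using d by simp
      also have "\<dots> \<le> (41/100) * sqrt (real n)"
        by (rule sqrt_div_le) (auto simp: power2_eq_square)
      finally show ?thesis .
    qed
    ultimately show ?thesis
      using psi_diff_le_factorial_ratio[of n] factorial_ratio_approx[of n] s1 by argo
  qed
qed

section \<open>Primes between \<open>3n\<close> and \<open>4n\<close> for large \<open>n\<close>\<close>

text \<open>
  If \<open>(a, b]\<close> contains no primes, only proper prime powers contribute to the sum. Consecutive
  powers of a prime differ by a factor of at least 2, so mapping a prime power to its prime is
  injective on \<open>(a, b]\<close> when \<open>b \<le> 2 a\<close>. It preserves \<open>\<Lambda>\<close>, and its values are at most \<open>s\<close> because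
  the square of the prime is at most \<open>b\<close>.
\<close>
lemma sum_mangoldt_composite_le:
  assumes "b \<le> 2 * a" "b < (s + 1) ^ 2" and np: "\<And>p. a < p \<Longrightarrow> p \<le> b \<Longrightarrow> \<not> prime p"
  shows "(\<Sum>d\<in>{a<..b}. mangoldt d) \<le> chebyshev_psi s"
proof -
  define Q where "Q = {d\<in>{a<..b}. primepow d}"
  have Q: "\<exists>p k. prime p \<and> k \<ge> 2 \<and> d = p ^ k \<and> aprimedivisor d = p" if "d \<in> Q" for d
  proof -
    from that obtain p k where pk: "prime p" "k > 0" "d = p ^ k"
      by (auto simp: Q_def primepow_def)
    hence "aprimedivisor d = p" by (simp add: aprimedivisor_prime_power)
    moreover have "k \<noteq> 1" using np[of d] that pk by (auto simp: Q_def)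
    ultimately show ?thesis using pk by (intro exI[of _ p] exI[of _ k]) auto
  qed
  have inj: "inj_on aprimedivisor Q"
  proof (rule linorder_inj_onI)
    fix d e assume de: "d < e" "d \<in> Q" "e \<in> Q"
    show "aprimedivisor d \<noteq> aprimedivisor e"
    proof
      assume "aprimedivisor d = aprimedivisor e"
      then obtain p i j where ij: "d = p ^ i" "e = p ^ j" and p: "prime p"
        using Q[OF de(2)] Q[OF de(3)] by metis
      have "i < j" using de(1) ij prime_gt_1_nat[OF p] by simp
      hence "p ^ Suc i \<le> p ^ j" using prime_gt_0_nat[OF p] by (intro power_increasing) auto
      moreover have "2 * p ^ i \<le> p ^ Suc i" using prime_ge_2_nat[OF p] by simp
      ultimately have "2 * d \<le> e" using ij by linarith
      moreover have "a < d" "e \<le> b" using de by (auto simp: Q_def)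
      ultimately show False using assms(1) by linarith
    qed
  qed auto
  have sub: "aprimedivisor ` Q \<subseteq> {1..s}"
  proof
    fix p assume "p \<in> aprimedivisor ` Q"
    then obtain d where d: "d \<in> Q" "p = aprimedivisor d" by auto
    then obtain k where k: "k \<ge> 2" "d = p ^ k" and p: "prime p" using Q[OF d(1)] by metis
    have "p ^ 2 \<le> p ^ k" using k prime_gt_0_nat[OF p] by (intro power_increasing) auto
    also have "\<dots> = d" by (rule k(2)[symmetric])
    also have "\<dots> \<le> b" using d(1) by (simp add: Q_def)
    also note assms(2)
    finally have "p ^ 2 < (s + 1) ^ 2" .
    hence "p < s + 1" by (rule power_less_imp_less_base) simp
    thus "p \<in> {1..s}" using prime_gt_0_nat[OF p] by auto
  qed
  have "(\<Sum>d\<in>{a<..b}. mangoldt d :: real) = (\<Sum>d\<in>Q. mangoldt d)"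
    by (rule sum.mono_neutral_right) (auto simp: Q_def mangoldt_def)
  also have "\<dots> = (\<Sum>d\<in>Q. mangoldt (aprimedivisor d))"
  proof (intro sum.cong refl)
    fix d assume "d \<in> Q"
    from Q[OF this] show "mangoldt d = (mangoldt (aprimedivisor d) :: real)" by auto
  qed
  also have "\<dots> = (\<Sum>p\<in>aprimedivisor ` Q. mangoldt p)"
    using inj by (simp add: sum.reindex)
  also have "\<dots> \<le> chebyshev_psi s"
    unfolding chebyshev_psi_def using sub by (intro sum_mono2) (auto simp: mangoldt_nonneg)
  finally show ?thesis .
qed

text \<open>
  In terms of \<open>r = sqrt n\<close>, the main term of \<open>\<psi>(4n) - \<psi>(3n)\<close> is \<open>(2/5) A r^2 \<ge> r^2 / 3\<close>, whereas
  the error terms and the contribution of proper prime powers are together below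
  \<open>29 r + 58\<close>. For \<open>r \<ge> 100\<close> the main term prevails.
\<close>
lemma prime_between_3n_4n_large:
  fixes n :: nat
  assumes "n \<ge> 10000"
  shows "\<exists>p. prime p \<and> 3 * n < p \<and> p \<le> 4 * n"
proof (rule ccontr)
  assume none: "\<not> ?thesis"
  define r where "r = sqrt (real n)"
  define s where "s = nat \<lfloor>2 * r\<rfloor>"
  have r2: "real n = r^2" by (simp add: r_def)
  have "sqrt (100^2) \<le> r" unfolding r_def using assms by (intro real_sqrt_le_mono) simp
  hence r: "r \<ge> 100" by simp
  have s: "real s \<le> 2 * r" "2 * r < real (s + 1)"
    unfolding s_def using r by (auto simp: of_nat_nat) linarith
  have "real (4 * n) = (2 * r)^2" by (simp add: r2 power2_eq_square)
  also have "\<dots> < real (s + 1) ^ 2" using s r by (intro power_strict_mono) auto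
  finally have "real (4 * n) < real ((s + 1)^2)" by simp
  hence "4 * n < (s + 1)^2" by (subst (asm) of_nat_less_iff)
  hence gap: "(\<Sum>d\<in>{3*n<..4*n}. mangoldt d) \<le> chebyshev_psi s"
    using none by (intro sum_mangoldt_composite_le) auto
  have split: "chebyshev_psi (4*n) = chebyshev_psi (3*n) + (\<Sum>d\<in>{3*n<..4*n}. mangoldt d)"
    by (rule chebyshev_psi_split) simp
  have "sqrt (real (4*n)) = 2 * r" by (simp add: r_def real_sqrt_mult)
  with psi_ge[of "4*n"]
  have lower: "chebyshev_psi (4*n) \<ge> 4 * (chebyshev_const * r^2) - 3 - 6 * r"
    by (simp add: r2)
  have "sqrt 3 \<le> 7/4" by (rule real_le_lsqrt) (auto simp: power2_eq_square)
  hence "sqrt (real (3*n)) \<le> 7/4 * r"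
    using mult_right_mono[of "sqrt 3" "7/4" r] r by (simp add: r_def real_sqrt_mult)
  with psi_le[of "3*n"]
  have upper: "chebyshev_psi (3*n) \<le> 18/5 * (chebyshev_const * r^2) + 77/4 * r"
    by (simp add: r2)
  \<comment> \<open>A linear bound for \<open>sqrt s\<close>, from the inequality of arithmetic and geometric means; the
      factor \<open>1/10\<close> makes its multiple by 11 small against \<open>r^2 / 3\<close>.\<close>
  have "sqrt (real s) \<le> r / 10 + 5"
  proof (rule real_le_lsqrt)
    have "0 \<le> (r / 10 - 5)^2" by simp
    hence "2 * r \<le> (r / 10 + 5)^2" by (simp add: power2_eq_square algebra_simps)
    thus "real s \<le> (r / 10 + 5)^2" using s by linarith
  qed (use r in auto)
  moreover have "chebyshev_const * real s \<le> 11/10 * (2 * r)"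
    using s chebyshev_const_bounds by (intro mult_mono) auto
  ultimately have small: "chebyshev_psi s \<le> 6/5 * (11/10 * (2 * r)) + 11 * (r / 10 + 5)"
    using psi_le[of s] by argo
  have "5/6 * r^2 \<le> chebyshev_const * r^2"
    using chebyshev_const_bounds by (intro mult_right_mono) auto
  moreover have "100 * r \<le> r^2" using r by (simp add: power2_eq_square)
  ultimately show False using gap split lower upper small r by argo
qed

section \<open>Small \<open>n\<close>\<close>

text \<open>
  A prime \<open>q\<close> serves all \<open>n\<close> with \<open>q/4 < n < q/3\<close>. The first \<open>n\<close> that its predecessor \<open>p\<close> does not
  serve is \<open>p/3\<close> rounded up, which equals \<open>(p + 2) div 3\<close>; so this number has to exceed \<open>q/4\<close>.
  The entry \<open>p\<close> before the list only marks where the covered range begins.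
\<close>
lemma prime_chain_covers:
  fixes p n :: nat
  assumes "successively (\<lambda>p q. q < 4 * ((p + 2) div 3)) (p # ps)"
      and "p \<le> 3 * n" "3 * n < last (p # ps)"
  shows "\<exists>q\<in>set ps. 3 * n < q \<and> q < 4 * n"
  using assms
proof (induction ps arbitrary: p)
  case Nil
  thus ?case by simp
next
  case (Cons q ps)
  show ?case
  proof (cases "3 * n < q")
    case True
    moreover have "(p + 2) div 3 \<le> n" using Cons.prems(2) by simp
    hence "q < 4 * n" using Cons.prems(1) by simp
    ultimately show ?thesis by auto
  next
    case False
    thus ?thesis using Cons.IH[of q] Cons.prems by auto
  qed
qed

lemma prime_by_trial_division:
  fixes p :: nat
  assumes "1 < p" "p < s ^ 2" and trial: "list_all (\<lambda>d. \<not> d dvd p) [2..<s]"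
  shows "prime p"
  unfolding prime_nat_iff
proof (intro conjI allI impI)
  show "1 < p" by fact
  have small: "d = 1" if "d dvd p" "d < s" for d
  proof -
    have "\<not> 2 \<le> d" using trial that by (auto simp: list_all_iff)
    thus "d = 1" using that assms(1) by (cases d) auto
  qed
  fix d assume "d dvd p"
  then obtain e where e: "p = d * e" by auto
  have "d < s \<or> e < s"
  proof (rule ccontr)
    assume "\<not> (d < s \<or> e < s)"
    hence "s * s \<le> d * e" by (intro mult_le_mono) auto
    thus False using assms(2) e by (simp add: power2_eq_square)
  qed
  thus "d = 1 \<or> d = p" using small[of d] small[of e] e by auto
qed

lemma prime_between_3n_4n_small:
  fixes n :: nat
  assumes "2 \<le> n" "n < 10000"
  shows "\<exists>p. prime p \<and> 3 * n < p \<and> p < 4 * n"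
proof -
  \<comment> \<open>Each prime is the largest one permitted after its predecessor, starting from 6; it is paired
      with a number whose square exceeds it, up to which trial division suffices.\<close>
  define ps :: "(nat \<times> nat) list" where "ps =
   [(7, 3), (11, 4), (13, 4), (19, 5), (23, 5), (31, 6), (43, 7), (59, 8), (79, 9),
    (107, 11), (139, 12), (181, 14), (241, 16), (317, 18), (421, 21), (563, 24),
    (751, 28), (997, 32), (1327, 37), (1759, 42), (2347, 49), (3121, 56), (4159, 65),
    (5531, 75), (7369, 86), (9817, 100), (13063, 115), (17419, 132), (23227, 153),
    (30971, 176)]"
  have trial: "list_all (\<lambda>(p, s). 1 < p \<and> p < s ^ 2 \<and> list_all (\<lambda>d. \<not> d dvd p) [2..<s]) ps"
    by (simp add: ps_def)
  have "\<exists>q\<in>set (map fst ps). 3 * n < q \<and> q < 4 * n"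
  proof (rule prime_chain_covers)
    show "successively (\<lambda>p q. q < 4 * ((p + 2) div 3)) (6 # map fst ps)"
      by (simp add: ps_def)
    show "6 \<le> 3 * n" using assms by simp
    show "3 * n < last (6 # map fst ps)" using assms by (simp add: ps_def)
  qed
  then obtain q s where q: "(q, s) \<in> set ps" "3 * n < q" "q < 4 * n" by auto
  have "prime q"
    using trial q(1) by (intro prime_by_trial_division[of q s]) (auto simp: list_all_iff)
  thus ?thesis using q by blast
qed

lemma prime_strictly_between_3n_4n:
  fixes n :: nat
  assumes n: "n \<ge> 2"
  shows "\<exists>p. prime p \<and> 3 * n < p \<and> p < 4 * n"
proof (cases "n < 10000")
  case True
  with n show ?thesis by (rule prime_between_3n_4n_small)
next
  case False
  then obtain p where p: "prime p" "3 * n < p" "p \<le> 4 * n"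
    using prime_between_3n_4n_large[of n] by auto
  have "\<not> prime (4 * n)" using n by (auto dest: prime_product)
  hence "p \<noteq> 4 * n" using p by auto
  with p show ?thesis by auto
qed

theorem theorem2p1:
  shows "(\<forall>n::nat. n \<ge> 1 \<longrightarrow> (\<exists>p::nat. prime p \<and> 3 * n \<le> p \<and> p \<le> 4 * n)) \<and>
         (\<forall>n::nat. n \<ge> 2 \<longrightarrow> (\<exists>p::nat. prime p \<and> 3 * n < p \<and> p < 4 * n))"
proof (intro conjI allI impI)
  fix n :: nat assume n: "n \<ge> 1"
  show "\<exists>p. prime p \<and> 3 * n \<le> p \<and> p \<le> 4 * n"
  proof (cases "n = 1")
    case True
    thus ?thesis by (intro exI[of _ 3]) simp
  next
    case False
    with n prime_strictly_between_3n_4n[of n] show ?thesis by (auto intro: less_imp_le)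
  qed
next
  fix n :: nat assume "n \<ge> 2"
  thus "\<exists>p. prime p \<and> 3 * n < p \<and> p < 4 * n" by (rule prime_strictly_between_3n_4n)
qed

end
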